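(* Let $V_1, V_2$ be positive integers and let $(V_m)_{m\ge 1}$ satisfy $V_m=V_{m-1}+V_{m-2}$ for $m\ge 3$. Let $n$ be a positive integer and let $d$ be an odd positive integer. If $\gcd(V_1,V_2)=1$ and $\gcd(V_n,F_d)=1$, then \[ \langle V_n,V_{n+d},V_{n+2d},\ldots\rangle=\langle V_n,V_{n+d}\rangle. \]
   Context: For a set $A$ of positive integers, $\langle A\rangle$ denotes the set of all finite linear combinations of elements of $A$ with non-negative integer coefficients. $F_m$ denotes the Fibonacci sequence: $F_0=0$, $F_1=F_2=1$, $F_m=F_{m-1}+F_{m-2}$. *)

theory Defs
  imports "HOL-Number_Theory.Fib"
begin

text \<open>
  The empty combination is included, so \<open>0\<close> always belongs to the generated set.
\<close>

definition nat_combinations :: "nat set \<Rightarrow> nat set" where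
  "nat_combinations A = {\<Sum>a\<in>B. c a * a | B c. finite B \<and> B \<subseteq> A}"

end

theory Submission
  imports Defs
begin

text \<open>
  For odd \<open>d\<close> one has \<open>V\<^bsub>m+2d\<^esub> = L\<^sub>d V\<^bsub>m+d\<^esub> + V\<^sub>m\<close>, where \<open>L\<^sub>d = 2 F\<^bsub>d-1\<^esub> + F\<^sub>d\<close> is a Lucas number; the
  sign of \<open>V\<^sub>m\<close> is \<open>-(-1)\<^sup>d = 1\<close>. Hence every \<open>V\<^bsub>n+kd\<^esub>\<close> is a combination of \<open>V\<^sub>n\<close> and \<open>V\<^bsub>n+d\<^esub>\<close> with
  non-negative coefficients, by induction on \<open>k\<close>.
\<close>

lemma nat_combinations_zero: "0 \<in> nat_combinations A"
  unfolding nat_combinations_def by (auto intro!: exI[of _ "{}"])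

lemma nat_combinations_incl: "a \<in> A \<Longrightarrow> a \<in> nat_combinations A"
  unfolding nat_combinations_def by (auto intro!: exI[of _ "{a}"] exI[of _ "\<lambda>_. 1"])

lemma nat_combinations_mono: "A \<subseteq> B \<Longrightarrow> nat_combinations A \<subseteq> nat_combinations B"
  unfolding nat_combinations_def by blast

lemma nat_combinations_add:
  assumes "x \<in> nat_combinations A" "y \<in> nat_combinations A"
  shows "x + y \<in> nat_combinations A"
proof -
  obtain B c where B: "finite B" "B \<subseteq> A" "x = (\<Sum>a\<in>B. c a * a)"
    using assms(1) unfolding nat_combinations_def by blast
  obtain C e where C: "finite C" "C \<subseteq> A" "y = (\<Sum>a\<in>C. e a * a)"
    using assms(2) unfolding nat_combinations_def by blast
  \<comment> \<open>\<open>c\<close> and \<open>e\<close> are arbitrary off \<open>B\<close> and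
    \<open>C\<close>, so each is cut to 0 there before both sums are extended to
    \<open>B \<union> C\<close>.\<close>
  let ?f = "\<lambda>a. (if a \<in> B then c a else 0) + (if a \<in> C then e a else 0)"
  have "x = (\<Sum>a\<in>B \<union> C. (if a \<in> B then c a else 0) * a)"
    unfolding B(3) using B C by (intro sum.mono_neutral_cong_left) auto
  moreover have "y = (\<Sum>a\<in>B \<union> C. (if a \<in> C then e a else 0) * a)"
    unfolding C(3) using B C by (intro sum.mono_neutral_cong_left) auto
  ultimately have "x + y = (\<Sum>a\<in>B \<union> C. ?f a * a)"
    by (simp only: distrib_right sum.distrib)
  moreover have "finite (B \<union> C)" "B \<union> C \<subseteq> A"
    using B C by auto
  ultimately show ?thesis
    unfolding nat_combinations_def by (intro CollectI exI[of _ "B \<union> C"] exI[of _ ?f] conjI)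
qed

lemma nat_combinations_mult:
  assumes "x \<in> nat_combinations A"
  shows "k * x \<in> nat_combinations A"
  using assms by (induction k) (auto intro: nat_combinations_zero nat_combinations_add)

text \<open>Reduces an inclusion of generated sets to a check on generators; closure under sums and
  multiples carries it through finite sums.\<close>

lemma nat_combinations_least:
  assumes "A \<subseteq> nat_combinations B"
  shows "nat_combinations A \<subseteq> nat_combinations B"
proof
  fix x assume "x \<in> nat_combinations A"
  then obtain C c where C: "finite C" "C \<subseteq> A" "x = (\<Sum>a\<in>C. c a * a)"
    unfolding nat_combinations_def by blast
  have "(\<Sum>a\<in>C. c a * a) \<in> nat_combinations B"
    using C(1,2)
  proof (induction rule: finite_induct)
    case empty
    then show ?case by (simp add: nat_combinations_zero)
  next
    case (insert a C)
    then have "c a * a \<in> nat_combinations B"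
      using assms by (intro nat_combinations_mult) auto
    with insert show ?case
      by (simp add: nat_combinations_add)
  qed
  then show "x \<in> nat_combinations B"
    by (simp only: C(3))
qed

text \<open>Both sides obey the Fibonacci recurrence in \<open>k\<close>. The offset
  \<open>Suc k\<close> avoids a truncated \<open>k - 1\<close> in the index of
  \<open>fib\<close>.\<close>

lemma fib_recurrence_shift:
  fixes U :: "nat \<Rightarrow> nat"
  assumes "\<And>i. U (i + 2) = U (i + 1) + U i"
  shows "U (i + Suc k) = fib k * U i + fib (Suc k) * U (i + 1)"
proof (induction k rule: fib.induct)
  case (3 k)
  have "U (i + Suc (Suc (Suc k))) = U (i + Suc (Suc k)) + U (i + Suc k)"
    using assms[of "i + Suc k"] by simp
  with 3 show ?case
    by (simp add: algebra_simps)
qed (use assms[of i] in simp_all)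

text \<open>Two shifts by \<open>d\<close> lead back to \<open>U i\<close> and
  \<open>U (i + 1)\<close>; Cassini's identity at the even index \<open>d - 1\<close> then lets a
  multiple of \<open>U (i + d)\<close> be split off, leaving exactly one \<open>U i\<close>.\<close>

lemma fib_recurrence_double_odd_shift:
  fixes U :: "nat \<Rightarrow> nat"
  assumes rec: "\<And>i. U (i + 2) = U (i + 1) + U i" and "odd d"
  shows "U (i + 2 * d) = (2 * fib (d - 1) + fib d) * U (i + d) + U i"
proof -
  obtain e where d: "d = Suc e" and "even e"
    using \<open>odd d\<close> by (cases d) auto
  let ?a = "fib e" and ?b = "fib (Suc e)"
  have "(?a + ?b) * ?a = ?b\<^sup>2 - 1"
    using fib_Cassini_nat[of e] \<open>even e\<close> by (simp add: add.commute)
  \<comment> \<open>Makes the truncated \<open>?b\<^sup>2 - 1\<close> a true difference, so the 1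
    can change sides.\<close>
  moreover have "?b\<^sup>2 \<ge> 1"
    by (simp add: Suc_leI fib_neq_0_nat)
  ultimately have cassini: "?b * ?b = (?a + ?b) * ?a + 1"
    by (simp add: power2_eq_square)
  have 1: "U (i + d) = ?a * U i + ?b * U (i + 1)"
    unfolding d by (rule fib_recurrence_shift[OF rec])
  have 2: "U (i + d + 1) = ?b * U i + (?a + ?b) * U (i + 1)"
    using fib_recurrence_shift[OF rec, of i "Suc e"] by (simp add: d add.commute)
  have "U (i + 2 * d) = ?a * U (i + d) + ?b * U (i + d + 1)"
    using fib_recurrence_shift[OF rec, of "i + d" e] by (simp add: d mult_2 add.assoc)
  also have "\<dots> = ?a * U (i + d) + (?b * ?b) * U i + ?b * (?a + ?b) * U (i + 1)"
    unfolding 2 by (simp add: algebra_simps)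
  \<comment> \<open>After substituting for \<open>?b * ?b\<close>, the factor \<open>?a + ?b\<close>
    multiplies \<open>?a * U i + ?b * U (i + 1)\<close>, which is \<open>U (i + d)\<close>.\<close>
  also have "\<dots> = (2 * ?a + ?b) * U (i + d) + U i"
    unfolding cassini 1 by (simp add: algebra_simps)
  finally show ?thesis
    by (simp add: d)
qed

theorem theorem3p1:
  fixes V :: "nat \<Rightarrow> nat" and n d :: nat
  assumes "V 1 > 0" and "V 2 > 0"
    and "\<And>m. m \<ge> 3 \<Longrightarrow> V m = V (m - 1) + V (m - 2)"
    and "n > 0"
    and "odd d"
    and "gcd (V 1) (V 2) = 1"
    and "gcd (V n) (fib d) = 1"
  shows "nat_combinations {V (n + k * d) | k. True} = nat_combinations {V n, V (n + d)}"
proof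
  \<comment> \<open>The recurrence for \<open>V\<close> starts at index 3; \<open>n > 0\<close> lets
    the shifted sequence satisfy it from \<open>i = 0\<close>.\<close>
  have rec: "V (n + (i + 2)) = V (n + (i + 1)) + V (n + i)" for i
    using assms(3)[of "n + (i + 2)"] \<open>n > 0\<close> by simp
  have "V (n + k * d) \<in> nat_combinations {V n, V (n + d)}" for k
  \<comment> \<open>The base cases 0 and 1 are the two generators themselves.\<close>
  proof (induction k rule: induct_nat_012)
    case (ge2 k)
    have "V (n + Suc (Suc k) * d)
        = (2 * fib (d - 1) + fib d) * V (n + Suc k * d) + V (n + k * d)"
      using fib_recurrence_double_odd_shift[of "\<lambda>i. V (n + i)", OF rec \<open>odd d\<close>, of "k * d"]
      by (simp add: algebra_simps mult_2_right)
    with ge2 show ?case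
      by (simp only: nat_combinations_add nat_combinations_mult)
  qed (simp_all add: nat_combinations_incl)
  then show "nat_combinations {V (n + k * d) | k. True} \<subseteq> nat_combinations {V n, V (n + d)}"
    by (intro nat_combinations_least) blast
  \<comment> \<open>Exhibits the witnesses \<open>k = 0\<close> and \<open>k = 1\<close> for
    \<open>blast\<close>.\<close>
  have "V n = V (n + 0 * d)" "V (n + d) = V (n + 1 * d)"
    by simp_all
  then show "nat_combinations {V n, V (n + d)} \<subseteq> nat_combinations {V (n + k * d) | k. True}"
    by (intro nat_combinations_mono) blast
qed

end
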